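(* Let $p\in\mathbb{N}$, let $\eta,\mu\in\mathbb{C}$ with $(\eta,\mu)\neq(0,0)$, and let $\gamma\in\mathbb{C}\setminus\{0\}$. Let $q$ be univalent in $\mathbb{U}$ with $q(0)=1$, and suppose $$\operatorname{Re}\left\{1+\frac{zq''(z)}{q'(z)}-\frac{zq'(z)}{q(z)}\right\}>0\qquad(z\in\mathbb{U}).$$ If $f\in\mathcal{A}_0$ with $\mathscr{F}_p^{\eta,\mu}[f](z)\neq 0$ for all $z\in\mathbb{U}$ satisfies $$1+\gamma\left[\eta\left(1-p+\frac{zf''(z)}{f'(z)}\right)+\mu\left(p-\frac{zf'(z)}{f(z)}\right)\right]\prec 1+\gamma\frac{zq'(z)}{q(z)}\qquad(z\in\mathbb{U}),\qquad(\ast)$$ then $\mathscr{F}_p^{\eta,\mu}[f](z)\prec q(z)$, and $q$ is the best dominant of the differential subordination $(\ast)$.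
   Context: $\mathbb{U}=\{z\in\mathbb{C}:|z|<1\}$. $\mathcal{A}_p$ is the class of analytic functions on $\mathbb{U}$ of the form $f(z)=z^p+\sum_{k=p+1}^\infty a_kz^k$. For $g,h$ analytic in $\mathbb{U}$, $g\prec h$ ($g$ is subordinate to $h$) means $g=h\circ\omega$ for some analytic $\omega:\mathbb{U}\to\mathbb{U}$ with $\omega(0)=0$. For $f\in\mathcal{A}_p$, $\mathscr{F}_p^{\eta,\mu}[f](z)=\left[\frac{f'(z)}{pz^{p-1}}\right]^{\eta}\left[\frac{z^p}{f(z)}\right]^{\mu}$, where all powers are principal, i.e. the analytic branches with value $1$ at $z=0$ (the bases being given the value $1$ at $z=0$ by removing the singularity). $\mathcal{A}_0$ is the set of $f\in\mathcal{A}_p$ for which $\mathscr{F}_p^{\eta,\mu}[f]$ is a well-defined analytic function on $\mathbb{U}$ with value $1$ at $z=0$. Best dominant: for a first-order differential subordination $\psi(\mathfrak{p}(z),z\mathfrak{p}'(z);z)\prec h(z)$, a function $q$ is a dominant if $\mathfrak{p}\prec q$ for all admissible analytic $\mathfrak{p}$ satisfying it; a univalent dominant $\tilde q$ with $\tilde q\prec q$ for all dominants $q$ is the best dominant. With $\mathfrak{p}=\mathscr{F}_p^{\eta,\mu}[f]$, the subordination $(\ast)$ is $1+\gamma z\mathfrak{p}'(z)/\mathfrak{p}(z)\prec 1+\gamma zq'(z)/q(z)$, the admissible functions being the analytic nonvanishing $\mathfrak{p}$ on $\mathbb{U}$ with $\mathfrak{p}(0)=1$. *)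

theory Defs
  imports "HOL-Complex_Analysis.Complex_Analysis"
begin

abbreviation unit_disc :: "complex set" ("\<U>") where
  "\<U> \<equiv> ball 0 1"

text \<open>Functions on the disc are total functions \<open>complex \<Rightarrow> complex\<close>; only their values
  on \<open>\<U>\<close> matter.\<close>

definition univalent :: "(complex \<Rightarrow> complex) \<Rightarrow> bool" where
  "univalent q \<longleftrightarrow> q holomorphic_on \<U> \<and> inj_on q \<U>"

definition subordinate :: "(complex \<Rightarrow> complex) \<Rightarrow> (complex \<Rightarrow> complex) \<Rightarrow> bool"
    (infix "\<prec>\<^sub>s" 50) where
  "g \<prec>\<^sub>s h \<longleftrightarrow> g holomorphic_on \<U> \<and> h holomorphic_on \<U> \<and>
     (\<exists>\<omega>. \<omega> holomorphic_on \<U> \<and> \<omega> ` \<U> \<subseteq> \<U> \<and> \<omega> 0 = 0 \<and> (\<forall>z\<in>\<U>. g z = h (\<omega> z)))"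

definition class_A :: "nat \<Rightarrow> (complex \<Rightarrow> complex) set" where
  "class_A p = {f. f holomorphic_on \<U> \<and>
     (\<exists>a :: nat \<Rightarrow> complex. \<forall>z\<in>\<U>. (\<lambda>k. a (p + 1 + k) * z ^ (p + 1 + k)) sums (f z - z ^ p))}"

text \<open>Both bases of \<open>\<F>\<close> tend to \<open>1\<close> at \<open>0\<close>, so in a punctured neighbourhood of \<open>0\<close> the
  library's principal power \<open>powr\<close> is the analytic branch with value \<open>1\<close> at \<open>0\<close>. On the rest of
  the disc the branch is the analytic continuation of this germ; it need not agree with the
  pointwise \<open>powr\<close>, which jumps when a base crosses the negative real axis.\<close>

definition is_F :: "nat \<Rightarrow> complex \<Rightarrow> complex \<Rightarrow> (complex \<Rightarrow> complex) \<Rightarrow> (complex \<Rightarrow> complex) \<Rightarrow> bool"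
  where
  "is_F p \<eta> \<mu> f F \<longleftrightarrow> F holomorphic_on \<U> \<and> F 0 = 1 \<and>
     (\<forall>\<^sub>F z in at 0. F z = (deriv f z / (of_nat p * z ^ (p - 1))) powr \<eta> * (z ^ p / f z) powr \<mu>)"

lemma is_F_unique:
  assumes "is_F p \<eta> \<mu> f F" "is_F p \<eta> \<mu> f G" "z \<in> \<U>"
  shows "F z = G z"
proof -
  have "\<forall>\<^sub>F z in at 0. F z = G z"
    using assms(1,2) unfolding is_F_def by (auto elim: eventually_elim2)
  then obtain r where r: "r > 0" "\<And>z. z \<noteq> 0 \<Longrightarrow> dist z 0 < r \<Longrightarrow> F z = G z"
    unfolding eventually_at by auto
  have "F w = G w" if "w \<in> ball 0 (min r 1)" for w
    using r(2)[of w] that assms(1,2) by (cases "w = 0") (auto simp: is_F_def dist_commute)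
  with r(1) assms show ?thesis
    by (intro analytic_continuation_open[of "ball 0 (min r 1)" "\<U>" F G z])
       (auto simp: is_F_def)
qed

text \<open>The choice is unambiguous on \<open>\<U>\<close> by \<open>is_F_unique\<close>.\<close>

definition F_op :: "nat \<Rightarrow> complex \<Rightarrow> complex \<Rightarrow> (complex \<Rightarrow> complex) \<Rightarrow> complex \<Rightarrow> complex"
    ("\<F>") where
  "\<F> p \<eta> \<mu> f = (SOME F. is_F p \<eta> \<mu> f F)"

definition class_A0 :: "nat \<Rightarrow> complex \<Rightarrow> complex \<Rightarrow> (complex \<Rightarrow> complex) set" where
  "class_A0 p \<eta> \<mu> = {f \<in> class_A p. \<exists>F. is_F p \<eta> \<mu> f F}"

text \<open>The quotients are singular at least at \<open>0\<close> (where \<open>f\<close> and, for \<open>p \<ge> 2\<close>, \<open>f'\<close> vanish), so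
  the expression denotes the function with its removable singularities filled in. Without
  \<open>remove_sings\<close> the convention \<open>x / 0 = 0\<close> would give a wrong value at \<open>0\<close>.\<close>

definition lhs_expr ::
  "nat \<Rightarrow> complex \<Rightarrow> complex \<Rightarrow> complex \<Rightarrow> (complex \<Rightarrow> complex) \<Rightarrow> complex \<Rightarrow> complex" where
  "lhs_expr p \<eta> \<mu> \<gamma> f = remove_sings (\<lambda>z.
     1 + \<gamma> * (\<eta> * (1 - of_nat p + z * deriv (deriv f) z / deriv f z)
            + \<mu> * (of_nat p - z * deriv f z / f z)))"

text \<open>In the next two definitions, \<open>Adm\<close> is the set of admissible functions, and the differential
  subordination is \<open>\<psi> (P z) (z * P' z) z \<prec> h z\<close>.\<close>

definition dominant ::
  "(complex \<Rightarrow> complex) set \<Rightarrow> (complex \<Rightarrow> complex \<Rightarrow> complex \<Rightarrow> complex) \<Rightarrow>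
     (complex \<Rightarrow> complex) \<Rightarrow> (complex \<Rightarrow> complex) \<Rightarrow> bool" where
  "dominant Adm \<psi> h q \<longleftrightarrow> q holomorphic_on \<U> \<and>
     (\<forall>P\<in>Adm. (\<lambda>z. \<psi> (P z) (z * deriv P z) z) \<prec>\<^sub>s h \<longrightarrow> P \<prec>\<^sub>s q)"

definition best_dominant ::
  "(complex \<Rightarrow> complex) set \<Rightarrow> (complex \<Rightarrow> complex \<Rightarrow> complex \<Rightarrow> complex) \<Rightarrow>
     (complex \<Rightarrow> complex) \<Rightarrow> (complex \<Rightarrow> complex) \<Rightarrow> bool" where
  "best_dominant Adm \<psi> h q \<longleftrightarrow> univalent q \<and> dominant Adm \<psi> h q \<and>
     (\<forall>q'. dominant Adm \<psi> h q' \<longrightarrow> q \<prec>\<^sub>s q')"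

definition admissible :: "(complex \<Rightarrow> complex) set" where
  "admissible = {P. P holomorphic_on \<U> \<and> (\<forall>z\<in>\<U>. P z \<noteq> 0) \<and> P 0 = 1}"

end

theory Submission
  imports Defs
begin

text \<open>The function \<open>Q z = z * q' z / q z\<close> satisfies \<open>Re (z * Q' z / Q z) > 0\<close>, so it is starlike,
  and since \<open>q' / q\<close> has no zeros it can be written as \<open>Q z = z * exp (L z)\<close>. For an admissible \<open>P\<close>
  the hypothesis reads \<open>z * P' z / P z = Q (\<omega> z)\<close> with a Schwarz function \<open>\<omega>\<close>. If \<open>P\<close> were not
  subordinate to \<open>q\<close>, Jack's lemma would give \<open>z\<^sub>0\<close> and \<open>\<zeta>\<close> with \<open>\<bar>z\<^sub>0\<bar> < \<bar>\<zeta>\<bar>\<close> and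
  \<open>Q (\<omega> z\<^sub>0) = m * Q \<zeta>\<close> for some \<open>m \<ge> 1\<close>, where \<open>\<bar>\<omega> z\<^sub>0\<bar> \<le> \<bar>z\<^sub>0\<bar>\<close>, which starlikeness excludes.
  That \<open>q\<close> is the best dominant is then clear, as \<open>q\<close> itself solves the differential subordination.\<close>

section \<open>Starlikeness of \<open>z * exp (L z)\<close>\<close>

text \<open>The argument of \<open>z * exp (L z)\<close> increases strictly, by \<open>2 * pi\<close> in total, along a circle
  around \<open>0\<close>.\<close>

lemma starlike_circle:
  fixes L :: "complex \<Rightarrow> complex"
  assumes hol: "L holomorphic_on \<U>"
    and pos: "\<And>z. z \<in> \<U> \<Longrightarrow> Re (1 + z * deriv L z) > 0"
    and w: "w \<in> \<U>" and eq: "cmod z = cmod w"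
    and ray: "z * exp (L z) = of_real s * (w * exp (L w))" and s: "s > 0"
  shows "z = w"
proof (cases "w = 0")
  case True
  with eq show ?thesis by simp
next
  case w0: False
  define \<theta> where "\<theta> = Arg2pi (z / w)"
  have "z / w = of_real (cmod (z / w)) * exp (\<i> * of_real \<theta>)"
    unfolding \<theta>_def by (rule Arg2pi_eq)
  then have z: "z = w * exp (\<i> * of_real \<theta>)"
    using eq w0 by (simp add: norm_divide field_simps)
  have th: "0 \<le> \<theta>" "\<theta> < 2 * pi"
    unfolding \<theta>_def by (rule Arg2pi_ge_0, rule Arg2pi_lt_2pi)
  \<comment> \<open>Up to the constant argument of \<open>w\<close>, this is a continuous branch of
    the argument of \<open>u * exp (L u)\<close> at \<open>u = w * exp (\<i> * of_real t)\<close>;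
    its derivative is \<open>Re (1 + u * deriv L u)\<close>.\<close>
  define \<phi> where "\<phi> t = t + Im (L (w * exp (\<i> * of_real t)))" for t :: real
  have deriv_\<phi>: "\<exists>y. (\<phi> has_real_derivative y) (at t) \<and> y > 0" for t
  proof -
    define u where "u = w * exp (\<i> * of_real t)"
    have u: "u \<in> \<U>" using w by (simp add: u_def norm_mult)
    have L: "(L has_field_derivative deriv L u) (at u)"
      using hol u by (intro holomorphic_derivI[of L \<U>]) auto
    have "((\<lambda>t. w * exp (\<i> * t)) has_field_derivative \<i> * u) (at (of_real t))"
      unfolding u_def by (auto intro!: derivative_eq_intros)
    from DERIV_chain2[OF L[unfolded u_def] this]
    have "((\<lambda>t. L (w * exp (\<i> * t))) has_field_derivative deriv L u * (\<i> * u)) (at (of_real t))"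
      by (simp add: u_def)
    then have "((\<lambda>t. L (w * exp (\<i> * of_real t))) has_vector_derivative deriv L u * (\<i> * u)) (at t)"
      by (rule has_vector_derivative_real_field)
    then have "((\<lambda>t. Im (L (w * exp (\<i> * of_real t)))) has_vector_derivative Im (deriv L u * (\<i> * u))) (at t)"
      by (rule bounded_linear.has_vector_derivative[OF bounded_linear_Im])
    then have "((\<lambda>t. Im (L (w * exp (\<i> * of_real t)))) has_real_derivative Im (deriv L u * (\<i> * u))) (at t)"
      by (simp add: has_real_derivative_iff_has_vector_derivative)
    then have "(\<phi> has_real_derivative 1 + Im (deriv L u * (\<i> * u))) (at t)"
      unfolding \<phi>_def by (intro DERIV_add DERIV_ident)
    moreover have "1 + Im (deriv L u * (\<i> * u)) > 0"
      using pos[OF u] by (simp add: algebra_simps)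
    ultimately show ?thesis by blast
  qed
  have incr: "\<phi> s < \<phi> t" if "s < t" for s t
    using that deriv_\<phi> by (rule DERIV_pos_imp_increasing)
  \<comment> \<open>Both values lie on one ray from 0, so the argument changes by a multiple of
    \<open>2 * pi\<close> between the angles 0 and \<open>\<theta>\<close>.\<close>
  have "w * (exp (\<i> * of_real \<theta>) * exp (L z)) = w * (of_real s * exp (L w))"
    using ray by (simp only: mult.assoc[symmetric] z[symmetric]) (simp only: ac_simps)
  then have "exp (\<i> * of_real \<theta>) * exp (L z) = of_real s * exp (L w)"
    using w0 by simp
  then have "exp (\<i> * of_real \<theta> + L z - L w) = of_real s"
    by (simp only: exp_add exp_diff) simp
  also have "\<dots> = exp (of_real (ln s))"
    using s by (simp add: exp_of_real)
  finally have "exp (\<i> * of_real \<theta> + L z - L w) = exp (of_real (ln s))" .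
  then obtain n :: int where "\<i> * of_real \<theta> + L z - L w = of_real (ln s) + of_int (2 * n) * pi * \<i>"
    by (auto simp: exp_eq)
  then have "Im (\<i> * of_real \<theta> + L z - L w) = 2 * of_int n * pi"
    by simp
  then have n: "\<phi> \<theta> - \<phi> 0 = 2 * pi * of_int n"
    by (simp add: \<phi>_def z)
  have period: "\<phi> (2 * pi) = \<phi> 0 + 2 * pi"
    by (simp add: \<phi>_def exp_eq_1 mult.commute)
  show ?thesis
  proof (cases "\<theta> = 0")
    case True
    then show ?thesis using z by simp
  next
    case False
    \<comment> \<open>Strict monotonicity puts this multiple strictly between 0 and the full turn
      \<open>2 * pi\<close>.\<close>
    with th have "0 < 2 * pi * of_int n" "2 * pi * of_int n < 2 * pi * 1"
      using incr[of 0 \<theta>] incr[of \<theta> "2 * pi"] n period by linarith+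
    then have "0 < (of_int n :: real)" "(of_int n :: real) < 1"
      by (simp add: zero_less_mult_iff) (use \<open>2 * pi * of_int n < 2 * pi * 1\<close> in simp)
    then have "0 < n" "n < 1" by simp_all
    then show ?thesis by linarith
  qed
qed

text \<open>Otherwise, among the points of the closed disc through \<open>w\<close> that are mapped to the ray
  beyond the value at \<open>w\<close>, one with an extremal image would lie in the open disc, against the
  open mapping theorem.\<close>

lemma starlike_strict:
  fixes L :: "complex \<Rightarrow> complex"
  assumes hol: "L holomorphic_on \<U>"
    and pos: "\<And>z. z \<in> \<U> \<Longrightarrow> Re (1 + z * deriv L z) > 0"
    and w: "w \<in> \<U>" and less: "cmod a < cmod w"
    and m: "m \<ge> 1"
  shows "a * exp (L a) \<noteq> of_real m * (w * exp (L w))"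
proof
  assume ray: "a * exp (L a) = of_real m * (w * exp (L w))"
  define r where "r = cmod w"
  have w0: "w \<noteq> 0" using less by auto
  have sub: "cball 0 r \<subseteq> \<U>" using w by (auto simp: r_def)
  \<comment> \<open>Normalised so that \<open>R w = 1\<close>: the ray through the value at
    \<open>w\<close> becomes the positive reals, and \<open>R a = m\<close>.\<close>
  define R where "R z = z * exp (L z) / (w * exp (L w))" for z
  have holR: "R holomorphic_on \<U>"
    unfolding R_def using w0 by (intro holomorphic_intros hol) auto
  define E where "E = {z \<in> cball 0 r. R z \<in> \<real> \<inter> {v. 1 \<le> Re v}}"
  have aE: "a \<in> E"
    using less m w0 by (simp add: E_def r_def R_def ray)
  have "closed E"
  proof -
    have "closed (cball 0 r \<inter> R -` (\<real> \<inter> {v. 1 \<le> Re v}))"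
      using holomorphic_on_subset[OF holR sub]
      by (intro continuous_closed_preimage holomorphic_on_imp_continuous_on
            closed_Int closed_complex_Reals closed_halfspace_Re_ge closed_cball)
    then show ?thesis by (simp add: E_def vimage_def Int_def conj_assoc)
  qed
  moreover have "bounded E"
    by (rule bounded_subset[of "cball 0 r"]) (auto simp: E_def)
  ultimately have "compact E" by (simp add: compact_eq_bounded_closed)
  moreover have "continuous_on E (\<lambda>z. Re (R z))"
    using sub
    by (intro continuous_on_Re holomorphic_on_imp_continuous_on holomorphic_on_subset[OF holR])
       (auto simp: E_def)
  ultimately obtain z1 where z1: "z1 \<in> E" "\<And>z. z \<in> E \<Longrightarrow> Re (R z) \<le> Re (R z1)"
    using continuous_attains_sup[of E "\<lambda>z. Re (R z)"] aE by blast
  \<comment> \<open>A maximum point on the circle can only be \<open>w\<close> by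
    \<open>starlike_circle\<close>, with value 1; since \<open>Re (R a) \<ge> 1\<close>, the
    interior point \<open>a\<close> is then a maximum point too.\<close>
  have "\<exists>b\<in>E. cmod b < r \<and> (\<forall>z\<in>E. Re (R z) \<le> Re (R b))"
  proof (cases "cmod z1 < r")
    case True
    then show ?thesis using z1 by blast
  next
    case False
    then have n: "cmod z1 = cmod w" using z1(1) by (auto simp: E_def r_def)
    have R1: "R z1 = of_real (Re (R z1))" "Re (R z1) \<ge> 1"
      using z1(1) by (auto simp: E_def)
    then have "z1 * exp (L z1) = of_real (Re (R z1)) * (w * exp (L w))"
      using w0 by (simp add: R_def field_simps)
    then have "z1 = w"
      using R1(2) by (intro starlike_circle[OF hol pos w n]) auto
    then have "Re (R z1) = 1" using w0 by (simp add: R_def)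
    moreover have "1 \<le> Re (R a)" using aE by (simp add: E_def)
    ultimately have "\<forall>z\<in>E. Re (R z) \<le> Re (R a)" using z1(2) by force
    then show ?thesis using aE less r_def by blast
  qed
  then obtain b where b: "b \<in> E" "cmod b < r" "\<And>z. z \<in> E \<Longrightarrow> Re (R z) \<le> Re (R b)"
    by blast
  have Rb: "R b \<in> \<real>" "1 \<le> Re (R b)" using b(1) by (auto simp: E_def)
  have "\<not> R constant_on ball 0 r"
  proof
    assume "R constant_on ball 0 r"
    then have "R b = R 0" using b(2) unfolding constant_on_def
      by (metis dist_0_norm mem_ball norm_ge_zero norm_zero order.strict_trans1)
    then show False using Rb(2) \<open>R b = R 0\<close> by (simp add: R_def[of 0])
  qed
  then have "open (R ` ball 0 r)"
    using holomorphic_on_subset[OF holR subset_trans[OF ball_subset_cball sub]]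
    by (intro open_mapping_thm[of R "ball 0 r"]) auto
  then obtain e where e: "e > 0" "cball (R b) e \<subseteq> R ` ball 0 r"
    using b(2) unfolding open_contains_cball by (metis image_eqI mem_ball_0)
  \<comment> \<open>Openness at \<open>b\<close> provides a real value beyond \<open>R b\<close>
    that is taken inside the disc, hence on \<open>E\<close>.\<close>
  have "R b + of_real e \<in> cball (R b) e" using e(1) by (simp add: dist_norm)
  then obtain c where c: "c \<in> ball 0 r" "R c = R b + of_real e"
    using e(2) by (metis imageE subsetD)
  have "c \<in> E" using c Rb e(1) by (auto simp: E_def)
  from b(3)[OF this] c(2) e(1) show False by simp
qed

section \<open>Jack's lemma\<close>

text \<open>The maximum of \<open>\<bar>f\<bar>\<close> on the circle makes \<open>z\<^sub>0 * f' z\<^sub>0 / f z\<^sub>0\<close> real, and Schwarz's lemma along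
  the radius through \<open>z\<^sub>0\<close> gives the bound \<open>m \<ge> 1\<close>.\<close>

lemma jack:
  fixes f :: "complex \<Rightarrow> complex"
  assumes hol: "f holomorphic_on V" and V: "open V" "cball 0 s \<subseteq> V"
    and f0: "f 0 = 0"
    and z0: "cmod z0 = s" "s > 0" and fz0: "f z0 \<noteq> 0"
    and max: "\<And>z. cmod z \<le> s \<Longrightarrow> cmod (f z) \<le> cmod (f z0)"
  obtains m :: real where "m \<ge> 1" "z0 * deriv f z0 = of_real m * f z0"
proof -
  define r where "r = cmod (f z0)"
  have r: "r > 0" using fz0 by (simp add: r_def)
  define g where "g t = f (of_real s * t) / of_real r" for t
  have holf: "f holomorphic_on ball 0 s" "continuous_on (cball 0 s) f"
    using holomorphic_on_subset[OF hol] V(2) ball_subset_cball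
    by (blast intro: holomorphic_on_imp_continuous_on)+
  have inj: "\<not> f constant_on ball 0 s"
  proof
    assume "f constant_on ball 0 s"
    then have c: "\<And>x. x \<in> ball 0 s \<Longrightarrow> f x = 0"
      using f0 z0(2) unfolding constant_on_def by force
    have "f z0 = 0"
    proof (rule continuous_constant_on_closure[of "ball 0 s" f])
      show "continuous_on (closure (ball 0 s)) f" using holf z0 by simp
    qed (use c z0 in auto)
    with fz0 show False by simp
  qed
  \<comment> \<open>The maximum principle makes the bound strict in the open disc, as Schwarz's
    lemma needs for \<open>g\<close>.\<close>
  have lt: "cmod (f z) < r" if "z \<in> ball 0 s" for z
  proof (rule ccontr)
    assume "\<not> cmod (f z) < r"
    then have "cmod (f x) \<le> cmod (f z)" if "x \<in> ball 0 s" for x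
      using max[of x] that by (simp add: r_def)
    then have "f constant_on ball 0 s"
      using that holf by (intro maximum_modulus_principle[of f "ball 0 s" "ball 0 s" z]) auto
    with inj show False by simp
  qed
  have holg: "g holomorphic_on ball 0 1"
    unfolding g_def using z0(2) r
    by (intro holomorphic_intros holomorphic_on_compose_gen[OF _ holf(1), unfolded o_def])
       (auto simp: norm_mult)
  have schwarz: "cmod (f z) \<le> r * cmod z / s" if "z \<in> ball 0 s" for z
  proof -
    have "cmod (g t) \<le> cmod t" if "cmod t < 1" for t
    proof (rule Schwarz_Lemma(1))
      show "cmod (g t) < 1" if "cmod t < 1" for t
        using lt[of "of_real s * t"] that z0(2) r by (simp add: g_def norm_mult norm_divide)
    qed (use holg that f0 in \<open>simp_all add: g_def[of 0]\<close>)
    from this[of "z / of_real s"] that z0(2) r show ?thesis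
      by (simp add: g_def norm_divide field_simps)
  qed
  \<comment> \<open>Logarithmic coordinates at \<open>z0\<close>: imaginary \<open>u\<close> moves
    along the circle, negative real \<open>u\<close> inwards along the radius, and \<open>k\<close>
    has derivative \<open>c\<close> at 0.\<close>
  define k where "k u = f (z0 * exp u) / f z0" for u
  define c where "c = z0 * deriv f z0 / f z0"
  have df: "(f has_field_derivative deriv f z0) (at z0)"
    using hol V z0 by (intro holomorphic_derivI[of f V]) auto
  have "((\<lambda>u. z0 * exp u) has_field_derivative z0) (at 0)"
    by (auto intro!: derivative_eq_intros)
  from DERIV_chain2[of f "deriv f z0" "\<lambda>u. z0 * exp u" 0, OF _ this] df
  have dk: "(k has_field_derivative c) (at 0)"
    unfolding k_def c_def using fz0 by (auto intro!: derivative_eq_intros)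
  have dir: "((\<lambda>t. Re (k (of_real t * v))) has_real_derivative Re (c * v)) (at 0)" for v
  proof -
    have "((\<lambda>t. t * v) has_field_derivative v) (at (of_real 0))"
      by (auto intro!: derivative_eq_intros)
    from DERIV_chain2[of k c "\<lambda>t. t * v" "of_real 0", OF _ this] dk
    have "((\<lambda>t. k (t * v)) has_field_derivative c * v) (at (of_real 0))" by simp
    then have "((\<lambda>t. k (of_real t * v)) has_vector_derivative c * v) (at 0)"
      by (rule has_vector_derivative_real_field)
    then have "((\<lambda>t. Re (k (of_real t * v))) has_vector_derivative Re (c * v)) (at 0)"
      by (rule bounded_linear.has_vector_derivative[OF bounded_linear_Re])
    then show ?thesis by (simp add: has_real_derivative_iff_has_vector_derivative)
  qed
  have k0: "k 0 = 1" using fz0 by (simp add: k_def)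
  \<comment> \<open>On the imaginary axis \<open>Re k \<le> cmod k \<le> 1 = k 0\<close>, so
    \<open>Re k\<close> has a maximum at 0 along it.\<close>
  have "Re (c * \<i>) = 0"
  proof (rule DERIV_local_max[OF dir[of \<i>], of 1])
    show "\<forall>y. \<bar>0 - y\<bar> < 1 \<longrightarrow> Re (k (of_real y * \<i>)) \<le> Re (k (of_real 0 * \<i>))"
    proof (intro allI impI)
      fix y :: real
      have "cmod (f (z0 * exp (of_real y * \<i>))) \<le> cmod (f z0)"
        by (rule max) (simp add: norm_mult z0)
      then have "cmod (k (of_real y * \<i>)) \<le> 1"
        using fz0 by (simp add: k_def norm_divide)
      then show "Re (k (of_real y * \<i>)) \<le> Re (k (of_real 0 * \<i>))"
        using complex_Re_le_cmod[of "k (of_real y * \<i>)"] k0 by simp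
    qed
  qed simp
  then have Im: "Im c = 0" by simp
  have Re: "Re c \<ge> 1"
  proof (rule ccontr)
    assume "\<not> Re c \<ge> 1"
    \<comment> \<open>Schwarz's lemma gives \<open>cmod (k (- h)) \<le> exp (- h)\<close>. If
      \<open>Re c < 1\<close>, the difference \<open>Re k - exp\<close> would have a negative
      derivative at its zero 0, hence be positive just to the left.\<close>
    have "((\<lambda>t. Re (k (of_real t * 1)) - exp t) has_real_derivative Re (c * 1) - 1) (at 0)"
      using DERIV_diff[OF dir[of 1] DERIV_exp[of 0]] by simp
    moreover have "Re (c * 1) - 1 < 0" using \<open>\<not> Re c \<ge> 1\<close> by simp
    ultimately obtain d where d: "d > 0"
      "\<forall>h>0. 0 - h \<in> UNIV \<longrightarrow> h < d \<longrightarrow> Re (k (of_real 0 * 1)) - exp 0 < Re (k (of_real (0 - h) * 1)) - exp (0 - h)"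
      using has_real_derivative_neg_dec_left[of _ _ 0 UNIV] by blast
    define h where "h = d / 2"
    have h: "h > 0" "h < d" using d(1) by (auto simp: h_def)
    with d(2) have "Re (k (of_real (- h))) > exp (- h)" by (force simp: k0)
    moreover have "cmod (k (of_real (- h))) \<le> exp (- h)"
      using schwarz[of "z0 * exp (of_real (-h))"] h(1) z0 r
      by (simp add: k_def norm_divide norm_mult r_def field_simps exp_minus)
    ultimately show False using complex_Re_le_cmod[of "k (of_real (- h))"] by linarith
  qed
  have "c = of_real (Re c)" using Im by (simp add: complex_eq_iff)
  then have "z0 * deriv f z0 = of_real (Re c) * f z0"
    using fz0 by (metis c_def nonzero_eq_divide_eq)
  with Re that show thesis by blast
qed


section \<open>Subordination by comparison of logarithmic derivatives\<close>

text \<open>Jack's lemma is applied to the inverse of \<open>q\<close> composed with \<open>P\<close>, at a point of least modulus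
  where \<open>P\<close> leaves the image under \<open>q\<close> of a disc of radius \<open>r < 1\<close>; working with \<open>r < 1\<close> avoids any
  assumption on the boundary behaviour of \<open>q\<close>.\<close>

lemma log_derivative_subordination:
  assumes q: "univalent q" "q 0 = 1" and qnz: "\<And>z. z \<in> \<U> \<Longrightarrow> q z \<noteq> 0"
    and pos: "\<And>z. z \<in> \<U> \<Longrightarrow>
      Re (1 + z * deriv (deriv q) z / deriv q z - z * deriv q z / q z) > 0"
    and P: "P \<in> admissible"
    and \<omega>: "\<omega> holomorphic_on \<U>" "\<omega> ` \<U> \<subseteq> \<U>" "\<omega> 0 = 0"
    and eq: "\<And>z. z \<in> \<U> \<Longrightarrow> z * deriv P z / P z = \<omega> z * deriv q (\<omega> z) / q (\<omega> z)"
  shows "P \<prec>\<^sub>s q"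
proof -
  have hq: "q holomorphic_on \<U>" and inj: "inj_on q \<U>"
    using q(1) by (auto simp: univalent_def)
  have dq: "deriv q z \<noteq> 0" if "z \<in> \<U>" for z
    using holomorphic_injective_imp_regular[OF hq _ inj that] by simp
  have hdq: "deriv q holomorphic_on \<U>" by (intro holomorphic_deriv hq) auto
  have hP: "P holomorphic_on \<U>" and P0: "P 0 = 1" using P by (auto simp: admissible_def)
  obtain L where L: "L holomorphic_on \<U>" "\<And>z. z \<in> \<U> \<Longrightarrow> exp (L z) = deriv q z / q z"
    using dq qnz by (rule_tac holomorphic_logarithm_exists[of \<U> "\<lambda>z. deriv q z / q z" 0])
      (auto intro!: holomorphic_intros hq hdq)
  \<comment> \<open>Logarithmic differentiation gives \<open>deriv L = q'' / q' - q' / q\<close>, so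
    the assumption on \<open>q\<close> becomes the starlikeness condition for
    \<open>z * exp (L z)\<close>.\<close>
  have posL: "Re (1 + z * deriv L z) > 0" if z: "z \<in> \<U>" for z
  proof -
    have dL: "(L has_field_derivative deriv L z) (at z)"
      using L(1) z by (intro holomorphic_derivI[of L \<U>]) auto
    have d1: "(q has_field_derivative deriv q z) (at z)"
      using hq z by (intro holomorphic_derivI[of q \<U>]) auto
    have d2: "(deriv q has_field_derivative deriv (deriv q) z) (at z)"
      using hdq z by (intro holomorphic_derivI[of _ \<U>]) auto
    have "((\<lambda>z. exp (L z)) has_field_derivative exp (L z) * deriv L z) (at z)"
      by (rule DERIV_fun_exp[OF dL])
    then have e1: "((\<lambda>z. deriv q z / q z) has_field_derivative exp (L z) * deriv L z) (at z)"
      by (rule has_field_derivative_transform_within_open[of _ _ _ \<U>]) (use z L(2) in auto)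
    have e2: "((\<lambda>z. deriv q z / q z) has_field_derivative
        (deriv (deriv q) z * q z - deriv q z * deriv q z) / (q z * q z)) (at z)"
      by (rule DERIV_divide[OF d2 d1 qnz[OF z]])
    have "deriv q z / q z * deriv L z =
        (deriv (deriv q) z * q z - deriv q z * deriv q z) / (q z * q z)"
      using DERIV_unique[OF e1 e2] L(2)[OF z] by simp
    then have "deriv L z = deriv (deriv q) z / deriv q z - deriv q z / q z"
      using dq[OF z] qnz[OF z] by (simp add: field_simps)
    then show ?thesis using pos[OF z] by (simp add: right_diff_distrib)
  qed
  obtain g where g: "g holomorphic_on q ` \<U>" "\<And>z. z \<in> \<U> \<Longrightarrow> g (q z) = z"
    using holomorphic_has_inverse[OF hq open_ball inj] by metis
  have open_q: "open (q ` S)" if "open S" "S \<subseteq> \<U>" for S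
    using that by (intro open_mapping_thm3 holomorphic_on_subset[OF hq] inj_on_subset[OF inj])
  \<comment> \<open>The part of the disc where the inverse of \<open>q\<close> can be applied to
    \<open>P\<close>; in the end it is the whole disc.\<close>
  define V where "V = \<U> \<inter> P -` (q ` \<U>)"
  have V: "open V"
    unfolding V_def using hP open_q[of \<U>]
    by (intro continuous_open_preimage holomorphic_on_imp_continuous_on) auto
  define f where "f z = g (P z)" for z
  have hf: "f holomorphic_on V"
    unfolding f_def
    by (rule holomorphic_on_compose_gen[OF _ g(1), unfolded o_def])
      (auto simp: V_def intro: holomorphic_on_subset[OF hP])
  have f0: "f 0 = 0" using g(2)[of 0] P0 q(2) by (simp add: f_def)
  have Pf: "P z = q (f z)" "f z \<in> \<U>" if "z \<in> V" for z
    using that g(2) by (auto simp: V_def f_def)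
  have inside: "P z \<in> q ` ball 0 r" if r: "r < 1" and z: "cmod z < r" for r z
  proof (rule ccontr)
    assume out: "P z \<notin> q ` ball 0 r"
    have r0: "r > 0" using z norm_ge_zero[of z] by linarith
    have sub: "cball 0 r \<subseteq> \<U>" "ball 0 r \<subseteq> \<U>" using r by auto
    \<comment> \<open>This set is compact and contains \<open>z\<close>, so it has a point
      \<open>z0\<close> closest to 0: the first exit from the image of
      \<open>ball 0 r\<close>.\<close>
    define K where "K = cball 0 (cmod z) \<inter> P -` (- (q ` ball 0 r))"
    have "closed K" unfolding K_def
    proof (intro continuous_closed_preimage closed_cball)
      show "continuous_on (cball 0 (cmod z)) P"
        using r z by (intro holomorphic_on_imp_continuous_on holomorphic_on_subset[OF hP]) auto
      show "closed (- (q ` ball 0 r))" using open_q[of "ball 0 r"] sub by (intro closed_Compl) auto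
    qed
    moreover have "z \<in> K" using out by (simp add: K_def)
    ultimately obtain z0 where z0: "z0 \<in> K" "\<And>y. y \<in> K \<Longrightarrow> dist 0 z0 \<le> dist 0 y"
      using distance_attains_inf[of K 0] by blast
    define s where "s = cmod z0"
    have sr: "s < r" using z0(1) z by (auto simp: K_def s_def)
    have s0: "s > 0"
    proof -
      have "1 \<in> q ` ball 0 r" using q(2) r0 by (auto intro!: image_eqI[of _ _ 0])
      then have "z0 \<noteq> 0" using z0(1) P0 by (auto simp: K_def)
      then show ?thesis by (simp add: s_def)
    qed
    have before: "P y \<in> q ` ball 0 r" if "cmod y < s" for y
    proof (rule ccontr)
      assume "P y \<notin> q ` ball 0 r"
      then have "y \<in> K" using that z0(1) by (auto simp: K_def s_def)
      from z0(2)[OF this] that show False by (simp add: s_def)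
    qed
    have contP: "continuous_on (closure (ball 0 s)) P"
      using s0 sr r by (intro holomorphic_on_imp_continuous_on holomorphic_on_subset[OF hP]) auto
    \<comment> \<open>The image of the closed disc is compact, so passing to the closure keeps
      \<open>f\<close> defined, with modulus at most \<open>r\<close>, on the circle through
      \<open>z0\<close>; at \<open>z0\<close> itself the modulus is then exactly
      \<open>r\<close>.\<close>
    have "closed (q ` cball 0 r)"
      using sub by (intro compact_imp_closed compact_continuous_image
          holomorphic_on_imp_continuous_on holomorphic_on_subset[OF hq]) auto
    moreover have "P ` ball 0 s \<subseteq> q ` cball 0 r"
      using before by fastforce
    ultimately have "P ` closure (ball 0 s) \<subseteq> q ` cball 0 r"
      by (intro image_closure_subset contP)
    then have upto: "P y \<in> q ` cball 0 r" if "cmod y \<le> s" for y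
      using that s0 by (auto simp: image_subset_iff)
    have fr: "y \<in> V \<and> cmod (f y) \<le> r" if y: "cmod y \<le> s" for y
    proof -
      obtain x where x: "x \<in> cball 0 r" "P y = q x" using upto[OF y] by blast
      with g(2)[of x] sub have "f y = x" by (auto simp: f_def)
      then show ?thesis using x sub y sr r by (auto simp: V_def)
    qed
    have sV: "cball 0 s \<subseteq> V" using fr by auto
    have z0V: "z0 \<in> V" using fr[of z0] by (simp add: s_def)
    have fz0: "cmod (f z0) = r"
    proof (rule ccontr)
      assume "cmod (f z0) \<noteq> r"
      then have "cmod (f z0) < r" using fr[of z0] by (simp add: s_def)
      then have "P z0 \<in> q ` ball 0 r" using Pf(1)[OF z0V] by auto
      then show False using z0(1) by (simp add: K_def)
    qed
    obtain m :: real where m: "m \<ge> 1" "z0 * deriv f z0 = of_real m * f z0"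
    proof (rule jack[OF hf V sV f0])
      show "cmod z0 = s" "s > 0" using s0 by (auto simp: s_def)
      show "f z0 \<noteq> 0" using fz0 r0 by auto
      show "cmod (f y) \<le> cmod (f z0)" if "cmod y \<le> s" for y
        using fr[OF that] fz0 by simp
    qed
    have fz0U: "f z0 \<in> \<U>" using fz0 r by simp
    have z0U: "z0 \<in> \<U>" using z0V by (simp add: V_def)
    have "(f has_field_derivative deriv f z0) (at z0)"
      by (rule holomorphic_derivI[OF hf V z0V])
    moreover have "(q has_field_derivative deriv q (f z0)) (at (f z0))"
      by (rule holomorphic_derivI[OF hq _ fz0U]) auto
    ultimately have "((\<lambda>z. q (f z)) has_field_derivative deriv q (f z0) * deriv f z0) (at z0)"
      by (intro DERIV_chain2)
    then have "(P has_field_derivative deriv q (f z0) * deriv f z0) (at z0)"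
      by (rule has_field_derivative_transform_within_open[OF _ V z0V]) (simp add: Pf)
    then have dP: "deriv P z0 = deriv q (f z0) * deriv f z0" by (rule DERIV_imp_deriv)
    \<comment> \<open>The chain rule for \<open>P z = q (f z)\<close> turns Jack's relation into the
      equation that \<open>starlike_strict\<close> excludes, since
      \<open>cmod (\<omega> z0) \<le> s < r = cmod (f z0)\<close>.\<close>
    have "\<omega> z0 * exp (L (\<omega> z0)) = z0 * deriv P z0 / P z0"
      using \<omega>(2) z0U eq[OF z0U] L(2)[of "\<omega> z0"] by (auto simp: image_subset_iff)
    also have "\<dots> = (z0 * deriv f z0) * (deriv q (f z0) / q (f z0))"
      by (simp add: dP Pf(1)[OF z0V])
    also have "\<dots> = of_real m * (f z0 * exp (L (f z0)))"
      by (simp add: m(2) L(2)[OF fz0U])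
    finally have "\<omega> z0 * exp (L (\<omega> z0)) = of_real m * (f z0 * exp (L (f z0)))" .
    moreover have "cmod (\<omega> z0) \<le> cmod z0"
      using \<omega> z0U by (intro Schwarz_Lemma(1)) (auto simp: image_subset_iff)
    then have "cmod (\<omega> z0) < cmod (f z0)" using sr fz0 by (simp add: s_def)
    ultimately show False using starlike_strict[OF L(1) posL fz0U _ m(1)] by blast
  qed
  have UV: "\<U> \<subseteq> V"
  proof
    fix z :: complex assume z: "z \<in> \<U>"
    then obtain r where r: "cmod z < r" "r < 1" using dense[of "cmod z" 1] by auto
    have "ball 0 r \<subseteq> \<U>" using r by auto
    then show "z \<in> V" using inside[OF r(2,1)] z by (auto simp: V_def)
  qed
  show ?thesis
    unfolding subordinate_def
  proof (intro conjI exI[of _ f] ballI)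
    show "f holomorphic_on \<U>" by (rule holomorphic_on_subset[OF hf UV])
  qed (use hP hq f0 Pf UV in blast)+
qed

section \<open>Absence of zeros of \<open>q\<close>\<close>

text \<open>At a zero \<open>a\<close> the quotient \<open>deriv q / q\<close> has a simple pole,
  which \<open>x / 0 = 0\<close> masks only at \<open>a\<close> itself. Clearing the denominator
  gives \<open>\<gamma> * a * deriv q a = 0\<close>, impossible as \<open>a \<noteq> 0\<close> and
  \<open>q\<close> is injective. In the theorem the holomorphy comes from
  \<open>\<prec>\<^sub>s\<close>.\<close>

lemma univalent_nonzero_if_log_derivative_holomorphic:
  assumes q: "univalent q" "q 0 \<noteq> 0" and \<gamma>: "\<gamma> \<noteq> 0"
    and h: "(\<lambda>z. 1 + \<gamma> * (z * deriv q z / q z)) holomorphic_on \<U>"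
    and a: "a \<in> \<U>"
  shows "q a \<noteq> 0"
proof
  assume qa: "q a = 0"
  have hq: "q holomorphic_on \<U>" and inj: "inj_on q \<U>"
    using q(1) by (auto simp: univalent_def)
  have hdq: "deriv q holomorphic_on \<U>" by (intro holomorphic_deriv hq) auto
  \<comment> \<open>The form \<open>1 + ... - 1\<close> keeps the function of \<open>h\<close>
    intact. \<open>N\<close> is continuous and vanishes near \<open>a\<close> off \<open>a\<close>,
    whereas at \<open>a\<close> its second term drops out.\<close>
  define N where "N z = \<gamma> * (z * deriv q z) - (1 + \<gamma> * (z * deriv q z / q z) - 1) * q z" for z
  have "N holomorphic_on \<U>"
    unfolding N_def by (intro holomorphic_on_diff holomorphic_on_mult h hq hdq
        holomorphic_on_const holomorphic_on_ident)
  then have "isCont N a"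
    using a holomorphic_on_imp_continuous_on continuous_on_eq_continuous_at open_ball by blast
  then have "N \<midarrow>a\<rightarrow> N a" by (simp add: isCont_def)
  moreover have "N \<midarrow>a\<rightarrow> 0"
  proof (rule tendsto_eventually)
    have "\<forall>\<^sub>F z in at a. z \<in> \<U> - {a}"
      using a by (intro eventually_at_in_open) auto
    then show "\<forall>\<^sub>F z in at a. N z = 0"
    proof eventually_elim
      case (elim z)
      then have "q z \<noteq> 0" using inj_onD[OF inj, of z a] qa a by auto
      then show ?case by (simp add: N_def)
    qed
  qed
  ultimately have "N a = 0" by (rule tendsto_unique[OF trivial_limit_at])
  moreover have "deriv q a \<noteq> 0"
    using holomorphic_injective_imp_regular[OF hq _ inj a] by simp
  moreover have "a \<noteq> 0" using qa q(2) by auto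
  ultimately show False using \<gamma> qa by (simp add: N_def)
qed

section \<open>The functional \<open>\<F>\<close> and its logarithmic derivative\<close>

text \<open>Splits off the zero of order \<open>p\<close> at 0; the remaining factor is close to 1
  there, so its principal logarithm is analytic near 0.\<close>

lemma class_A_factor:
  assumes "f \<in> class_A p"
  obtains G where "G holomorphic_on \<U>" "G 0 = 1" "\<And>z. z \<in> \<U> \<Longrightarrow> f z = z ^ p * G z"
proof -
  obtain a where a: "\<And>z. z \<in> \<U> \<Longrightarrow>
      (\<lambda>k. a (p + 1 + k) * z ^ (p + 1 + k)) sums (f z - z ^ p)"
    using assms unfolding class_A_def by blast
  \<comment> \<open>The value at 0 is the constant term of the shifted series, so \<open>H\<close>
    is given by a power series on the whole disc.\<close>
  define H where "H z = (if z = 0 then a (p + 1) else (f z - z ^ p) / z ^ (p + 1))" for z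
  have "(\<lambda>k. a (p + 1 + k) * (z - 0) ^ k) sums H z" if "z \<in> \<U>" for z
  proof (cases "z = 0")
    case True
    then show ?thesis using powser_sums_zero[of "\<lambda>k. a (p + 1 + k)"] by (simp add: H_def)
  next
    case False
    have "(\<lambda>k. a (p + 1 + k) * z ^ (p + 1 + k) / z ^ (p + 1)) sums H z"
      using sums_divide[OF a[OF that], of "z ^ (p + 1)"] False by (simp add: H_def)
    moreover have "a (p + 1 + k) * z ^ (p + 1 + k) / z ^ (p + 1) = a (p + 1 + k) * (z - 0) ^ k" for k
      using False by (simp add: power_add)
    ultimately show ?thesis by simp
  qed
  then have "H holomorphic_on \<U>" by (rule power_series_holomorphic)
  then have "(\<lambda>z. 1 + z * H z) holomorphic_on \<U>" by (intro holomorphic_intros)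
  moreover have "f z = z ^ p * (1 + z * H z)" if "z \<in> \<U>" for z
  proof (cases "z = 0")
    case True
    have "f 0 - 0 ^ p = 0"
      using sums_unique2[OF a[of 0], of 0] by simp
    then show ?thesis using True by simp
  next
    case False
    then show ?thesis by (simp add: H_def field_simps)
  qed
  ultimately show thesis using that by simp
qed

text \<open>With \<open>f z = z ^ p * G z\<close> and
  \<open>deriv f z = p * z ^ (p - 1) * D z\<close>, the bases of the powers are \<open>D\<close> and
  \<open>1 / G\<close>. So \<open>F = exp (\<eta> * Ln D - \<mu> * Ln G)\<close> near 0, and
  logarithmic differentiation gives the formula.\<close>

lemma is_F_log_derivative:
  assumes p: "p \<ge> 1" and f: "f \<in> class_A p" and F: "is_F p \<eta> \<mu> f F"
  shows "\<forall>\<^sub>F z in at 0. \<eta> * (1 - of_nat p + z * deriv (deriv f) z / deriv f z)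
      + \<mu> * (of_nat p - z * deriv f z / f z) = z * deriv F z / F z"
proof -
  obtain n where n: "p = Suc n" using p by (cases p) auto
  obtain G where G: "G holomorphic_on \<U>" "G 0 = 1" "\<And>z. z \<in> \<U> \<Longrightarrow> f z = z ^ p * G z"
    using class_A_factor[OF f] by blast
  define D where "D z = G z + z * deriv G z / of_nat p" for z
  have hdG: "deriv G holomorphic_on \<U>" by (intro holomorphic_deriv G) auto
  have hD: "D holomorphic_on \<U>"
    unfolding D_def using p by (intro holomorphic_intros G hdG) auto
  have D0: "D 0 = 1" by (simp add: D_def G)
  have dG: "(G has_field_derivative deriv G z) (at z)" if "z \<in> \<U>" for z
    using that by (intro holomorphic_derivI[OF G(1)]) auto
  have dD: "(D has_field_derivative deriv D z) (at z)" if "z \<in> \<U>" for z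
    using that by (intro holomorphic_derivI[OF hD]) auto
  \<comment> \<open>For \<open>n = 0\<close> the truncated exponent \<open>n - 1\<close> is
    harmless, as the factor \<open>of_nat n\<close> vanishes.\<close>
  have zn: "z * (of_nat n * z ^ (n - 1)) = of_nat n * z ^ n" for z :: complex
    by (cases n) auto
  have df: "deriv f z = of_nat p * z ^ n * D z" if z: "z \<in> \<U>" for z
  proof -
    have "of_nat p * D z = of_nat p * G z + z * deriv G z"
      using p by (simp add: D_def distrib_left)
    from arg_cong[OF this, of "\<lambda>x. z ^ n * x"]
    have "of_nat p * z ^ n * D z = of_nat p * z ^ n * G z + deriv G z * z ^ p"
      by (simp add: n algebra_simps del: of_nat_Suc)
    moreover have "((\<lambda>z. z ^ p * G z) has_field_derivative
        of_nat p * z ^ n * G z + deriv G z * z ^ p) (at z)"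
      using DERIV_mult[OF DERIV_power[OF DERIV_ident, of p] dG[OF z]] by (simp add: n)
    ultimately have "((\<lambda>z. z ^ p * G z) has_field_derivative of_nat p * z ^ n * D z) (at z)"
      by simp
    then have "(f has_field_derivative of_nat p * z ^ n * D z) (at z)"
      by (rule has_field_derivative_transform_within_open[of _ _ _ \<U>]) (use z G(3) in auto)
    then show ?thesis by (rule DERIV_imp_deriv)
  qed
  have ddf: "z * deriv (deriv f) z = of_nat p * z ^ n * (of_nat n * D z + z * deriv D z)"
    if z: "z \<in> \<U>" for z
  proof -
    have "((\<lambda>z. of_nat p * z ^ n * D z) has_field_derivative
        of_nat p * (of_nat n * z ^ (n - 1)) * D z + of_nat p * z ^ n * deriv D z) (at z)"
      using dD[OF z] by (auto intro!: derivative_eq_intros)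
    then have "(deriv f has_field_derivative
        of_nat p * (of_nat n * z ^ (n - 1)) * D z + of_nat p * z ^ n * deriv D z) (at z)"
      by (rule has_field_derivative_transform_within_open[of _ _ _ \<U>]) (use z df in auto)
    then have "z * deriv (deriv f) z =
        of_nat p * (z * (of_nat n * z ^ (n - 1))) * D z + of_nat p * z ^ n * (z * deriv D z)"
      by (simp add: DERIV_imp_deriv ring_distribs mult_ac)
    then show ?thesis by (simp only: zn ring_distribs mult_ac)
  qed
  \<comment> \<open>Positive real parts keep \<open>D\<close> and \<open>G\<close> off the branch
    cut of \<open>Ln\<close>.\<close>
  have "(\<lambda>z. Re (D z)) \<midarrow>0\<rightarrow> Re 1" "(\<lambda>z. Re (G z)) \<midarrow>0\<rightarrow> Re 1"
    using DERIV_isCont[OF dD[of 0]] DERIV_isCont[OF dG[of 0]] D0 G(2)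
    by (auto simp: isCont_def simp del: one_complex.sel intro!: tendsto_Re)
  then have "\<forall>\<^sub>F z in at 0. Re (D z) > 0" "\<forall>\<^sub>F z in at 0. Re (G z) > 0"
    by (auto intro: order_tendstoD(1))
  moreover have "\<forall>\<^sub>F z in at 0. z \<in> \<U> - {0}"
    by (intro eventually_at_in_open) auto
  ultimately have "\<forall>\<^sub>F z in at 0. z \<in> \<U> \<and> Re (D z) > 0 \<and> Re (G z) > 0 \<and> z \<noteq> 0"
    by eventually_elim auto
  moreover have "\<forall>\<^sub>F z in at 0. F z =
      (deriv f z / (of_nat p * z ^ (p - 1))) powr \<eta> * (z ^ p / f z) powr \<mu>"
    using F by (simp add: is_F_def)
  ultimately have "\<forall>\<^sub>F z in at 0. z \<in> \<U> \<and> z \<noteq> 0 \<and> Re (D z) > 0 \<and> Re (G z) > 0 \<and>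
      F z = exp (\<eta> * Ln (D z) - \<mu> * Ln (G z))"
  proof eventually_elim
    case (elim z)
    then have nz: "D z \<noteq> 0" "G z \<noteq> 0" "G z \<notin> \<real>\<^sub>\<le>\<^sub>0"
      by (auto simp: complex_nonpos_Reals_iff)
    have "deriv f z / (of_nat p * z ^ (p - 1)) = D z" "z ^ p / f z = inverse (G z)"
      using elim df[of z] G(3)[of z] nz by (simp_all add: n inverse_eq_divide del: of_nat_Suc)
    then show ?case
      using elim nz by (simp add: powr_def Ln_inverse exp_diff exp_minus divide_inverse)
  qed
  then obtain S where S: "open S" "0 \<in> S" "\<And>z. z \<in> S - {0} \<Longrightarrow> z \<in> \<U> \<and> Re (D z) > 0 \<and>
      Re (G z) > 0 \<and> F z = exp (\<eta> * Ln (D z) - \<mu> * Ln (G z))"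
    unfolding eventually_at_topological by blast
  have "\<forall>\<^sub>F z in at 0. z \<in> S - {0}" using S by (intro eventually_at_in_open) auto
  then show ?thesis
  proof eventually_elim
    case (elim z)
    note z = S(3)[OF elim]
    have nz: "z \<noteq> 0" "D z \<noteq> 0" "G z \<noteq> 0" "D z \<notin> \<real>\<^sub>\<le>\<^sub>0" "G z \<notin> \<real>\<^sub>\<le>\<^sub>0" "of_nat p \<noteq> (0::complex)"
      using z elim p by (auto simp: complex_nonpos_Reals_iff)
    have "((\<lambda>z. exp (\<eta> * Ln (D z) - \<mu> * Ln (G z))) has_field_derivative
        F z * (\<eta> * (deriv D z / D z) - \<mu> * (deriv G z / G z))) (at z)"
      using z nz dD[of z] dG[of z]
      by (auto intro!: derivative_eq_intros simp: divide_inverse mult_ac)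
    then have "(F has_field_derivative
        F z * (\<eta> * (deriv D z / D z) - \<mu> * (deriv G z / G z))) (at z)"
      by (rule has_field_derivative_transform_within_open[of _ _ _ "S - {0}"])
        (use S elim in auto)
    then have dF: "deriv F z = F z * (\<eta> * (deriv D z / D z) - \<mu> * (deriv G z / G z))"
      by (rule DERIV_imp_deriv)
    have "F z \<noteq> 0" using z by simp
    then have "z * deriv F z / F z = z * (\<eta> * (deriv D z / D z) - \<mu> * (deriv G z / G z))"
      unfolding dF by (simp only: mult.left_commute[of z "F z"] nonzero_mult_div_cancel_left not_False_eq_True)
    then have zF: "z * deriv F z / F z = \<eta> * (z * deriv D z / D z) + \<mu> * - (z * deriv G z / G z)"
      by (simp add: algebra_simps)
    \<comment> \<open>The summand \<open>n = p - 1\<close> cancels the \<open>1 - p\<close> of the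
      expression.\<close>
    have "z * deriv (deriv f) z / deriv f z = of_nat n + z * deriv D z / D z"
      using z nz by (simp add: df ddf add_divide_distrib)
    then have e1: "1 - of_nat p + z * deriv (deriv f) z / deriv f z = z * deriv D z / D z"
      by (simp add: n)
    have "z * deriv f z / f z = of_nat p * D z / G z"
      using z nz by (simp add: df G(3) n)
    also have "of_nat p * D z = of_nat p * G z + z * deriv G z"
      using nz by (simp add: D_def field_simps)
    finally have e2: "of_nat p - z * deriv f z / f z = - (z * deriv G z / G z)"
      using nz by (simp add: add_divide_distrib)
    show ?case unfolding zF e1 e2 ..
  qed
qed

text \<open>Identity theorem: both sides are holomorphic on the disc, the left by assumption and the
  right because \<open>F\<close> has no zeros, and they agree near 0 by
  \<open>is_F_log_derivative\<close>.\<close>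

lemma lhs_expr_eq_log_derivative:
  assumes p: "p \<ge> 1" and f: "f \<in> class_A p" and F: "is_F p \<eta> \<mu> f F"
    and nz: "\<And>z. z \<in> \<U> \<Longrightarrow> F z \<noteq> 0"
    and hol: "lhs_expr p \<eta> \<mu> \<gamma> f holomorphic_on \<U>"
    and z: "z \<in> \<U>"
  shows "lhs_expr p \<eta> \<mu> \<gamma> f z = 1 + \<gamma> * (z * deriv F z / F z)"
proof -
  define T where "T z = 1 + \<gamma> * (z * deriv F z / F z)" for z
  define E where "E z = 1 + \<gamma> * (\<eta> * (1 - of_nat p + z * deriv (deriv f) z / deriv f z)
      + \<mu> * (of_nat p - z * deriv f z / f z))" for z
  have hF: "F holomorphic_on \<U>" using F by (simp add: is_F_def)
  have hT: "T holomorphic_on \<U>"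
    unfolding T_def by (intro holomorphic_intros hF nz) auto
  have "\<forall>\<^sub>F z in at 0. E z = T z"
    using is_F_log_derivative[OF p f F] by eventually_elim (simp add: E_def T_def)
  then obtain S where S: "open S" "0 \<in> S" "\<And>z. z \<in> S - {0} \<Longrightarrow> E z = T z"
    unfolding eventually_at_topological by blast
  \<comment> \<open>\<open>remove_sings\<close> depends only on punctured neighbourhoods and leaves
    the analytic \<open>T\<close> unchanged, so equality off 0 extends to 0.\<close>
  have near: "remove_sings E w = T w" if w: "w \<in> S \<inter> \<U>" for w
  proof -
    have "\<forall>\<^sub>F v in at w. v \<in> S - {w}"
      using w S by (intro eventually_at_in_open) auto
    moreover have "\<forall>\<^sub>F v in at w. v \<noteq> 0"
      by (rule eventually_neq_at_within)
    ultimately have "\<forall>\<^sub>F v in at w. E v = T v"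
      by eventually_elim (use S in auto)
    then have "remove_sings E w = remove_sings T w"
      by (rule remove_sings_cong) simp
    also have "T analytic_on {w}"
      using hT w analytic_at_two by (metis IntE analytic_at open_ball)
    then have "remove_sings T w = T w" by simp
    finally show ?thesis .
  qed
  have lhs: "lhs_expr p \<eta> \<mu> \<gamma> f = remove_sings E"
    unfolding lhs_expr_def E_def ..
  have "lhs_expr p \<eta> \<mu> \<gamma> f z = T z"
  proof (rule analytic_continuation_open[OF _ open_ball _ connected_ball _ hol hT _ z])
    show "S \<inter> \<U> \<noteq> {}" using S by auto
  qed (use S near lhs in auto)
  then show ?thesis by (simp add: T_def)
qed

theorem theorem3p1:
  fixes p :: nat and \<eta> \<mu> \<gamma> :: complex and q f :: "complex \<Rightarrow> complex"
  assumes "p \<ge> 1"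
    and "(\<eta>, \<mu>) \<noteq> (0, 0)"
    and "\<gamma> \<noteq> 0"
    and "univalent q"
    and "q 0 = 1"
    and "\<forall>z\<in>\<U>. Re (1 + z * deriv (deriv q) z / deriv q z - z * deriv q z / q z) > 0"
    and "f \<in> class_A0 p \<eta> \<mu>"
    and "\<forall>z\<in>\<U>. \<F> p \<eta> \<mu> f z \<noteq> 0"
    and "lhs_expr p \<eta> \<mu> \<gamma> f \<prec>\<^sub>s (\<lambda>z. 1 + \<gamma> * (z * deriv q z / q z))"
  shows "\<F> p \<eta> \<mu> f \<prec>\<^sub>s q \<and>
    best_dominant admissible (\<lambda>r s z. 1 + \<gamma> * s / r) (\<lambda>z. 1 + \<gamma> * (z * deriv q z / q z)) q"
proof -
  let ?h = "\<lambda>z. 1 + \<gamma> * (z * deriv q z / q z)"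
  let ?\<psi> = "\<lambda>r s (z::complex). 1 + \<gamma> * s / r"
  have hol: "lhs_expr p \<eta> \<mu> \<gamma> f holomorphic_on \<U>" "?h holomorphic_on \<U>"
    using assms(9) by (auto simp: subordinate_def)
  have qnz: "q z \<noteq> 0" if "z \<in> \<U>" for z
    using univalent_nonzero_if_log_derivative_holomorphic[OF assms(4) _ assms(3) hol(2) that] assms(5)
    by simp
  have main: "P \<prec>\<^sub>s q" if P: "P \<in> admissible"
    and sub: "(\<lambda>z. ?\<psi> (P z) (z * deriv P z) z) \<prec>\<^sub>s ?h" for P
  proof -
    obtain \<omega> where \<omega>: "\<omega> holomorphic_on \<U>" "\<omega> ` \<U> \<subseteq> \<U>" "\<omega> 0 = 0"
      "\<And>z. z \<in> \<U> \<Longrightarrow> 1 + \<gamma> * (z * deriv P z) / P z = ?h (\<omega> z)"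
      using sub unfolding subordinate_def by blast
    have "z * deriv P z / P z = \<omega> z * deriv q (\<omega> z) / q (\<omega> z)" if "z \<in> \<U>" for z
      using \<omega>(4)[OF that] assms(3) by (simp flip: times_divide_eq_right)
    from log_derivative_subordination[OF assms(4,5) qnz _ P \<omega>(1-3) this] assms(6)
    show ?thesis by simp
  qed
  define F where "F = \<F> p \<eta> \<mu> f"
  \<comment> \<open>Membership in \<open>class_A0\<close> provides a witness, so the choice in
    \<open>\<F>\<close> satisfies \<open>is_F\<close>.\<close>
  have fA: "f \<in> class_A p" and F: "is_F p \<eta> \<mu> f F"
    using assms(7) someI_ex[of "is_F p \<eta> \<mu> f"] by (simp_all add: class_A0_def F_def F_op_def)
  have Fnz: "F z \<noteq> 0" if "z \<in> \<U>" for z using assms(8) that by (simp add: F_def)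
  have F_adm: "F \<in> admissible" using F Fnz by (simp add: admissible_def is_F_def)
  have eqF: "lhs_expr p \<eta> \<mu> \<gamma> f z = ?\<psi> (F z) (z * deriv F z) z" if "z \<in> \<U>" for z
    using lhs_expr_eq_log_derivative[OF assms(1) fA F Fnz hol(1) that] by simp
  have "(\<lambda>z. ?\<psi> (F z) (z * deriv F z) z) \<prec>\<^sub>s ?h"
    using assms(9) holomorphic_cong[THEN iffD1, OF refl eqF hol(1)] unfolding subordinate_def
    by (simp add: eqF del: mem_ball mem_ball_0 cong: ball_cong)
  then have 1: "F \<prec>\<^sub>s q" by (rule main[OF F_adm])
  have hq: "q holomorphic_on \<U>" using assms(4) by (simp add: univalent_def)
  have "q \<in> admissible" using hq qnz assms(5) by (simp add: admissible_def)
  \<comment> \<open>The Schwarz function here is the identity; every dominant must therefore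
    dominate \<open>q\<close> itself.\<close>
  moreover have "(\<lambda>z. ?\<psi> (q z) (z * deriv q z) z) \<prec>\<^sub>s ?h"
    unfolding subordinate_def using hol(2) by (auto intro!: exI[of _ "\<lambda>z. z"])
  ultimately have "best_dominant admissible ?\<psi> ?h q"
    unfolding best_dominant_def dominant_def using assms(4) hq main by blast
  with 1 show ?thesis by (simp add: F_def)
qed

end
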